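(* Let $\mathfrak{m}$ be a convex polyhedron in $\mathbb{R}^3$ with vertex set $\{\mathbf{v}_i\}$. Given any set of generalized barycentric coordinates $\{\lambda_i\}$ associated to $\mathfrak{m}$, $$\frac12\sum_{i,j,k}\lambda_i(\nabla\lambda_j\times\nabla\lambda_k)\bigl((\mathbf{v}_j-\mathbf{v}_i)\times(\mathbf{v}_k-\mathbf{v}_i)\bigr)^T=\mathbb{I},$$ where $\mathbb{I}$ is the $3\times3$ identity matrix. Further, for any real $3\times3$ matrix $\mathbb{A}$, $$\frac12\sum_{i,j,k}\bigl(\mathbb{A}\mathbf{v}_i\cdot(\mathbf{v}_j\times\mathbf{v}_k)\bigr)\,\lambda_i\nabla\lambda_j\times\nabla\lambda_k=\mathbb{A}\mathbf{x}.$$ Thus, $\operatorname{span}\{\lambda_i\nabla\lambda_j\times\nabla\lambda_k : \mathbf{v}_i,\mathbf{v}_j,\mathbf{v}_k\in\mathfrak{m}\}\supseteq\mathcal{P}_1\Lambda^2(\mathfrak{m})$.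
   Context: Generalized barycentric coordinates on $\mathfrak{m}$: non-negative functions $\lambda_i:\mathfrak{m}\to\mathbb{R}$, one for each vertex $\mathbf{v}_i$, such that every linear function $L$ (polynomial of degree at most 1) satisfies $L=\sum_i L(\mathbf{v}_i)\lambda_i$ on $\mathfrak{m}$. All sums run over all vertex indices of $\mathfrak{m}$ independently. Vectors (vertices, gradients, cross products, and the position $\mathbf{x}=(x_1,x_2,x_3)^T$) are column vectors; $\mathbf{v}_i\in\mathfrak{m}$ in the span refers to vertices of $\mathfrak{m}$. The $\lambda_i$ are assumed differentiable wherever gradients are written: the identities and the span inclusion are understood as statements about functions of $\mathbf{x}$ on the set of points of $\mathfrak{m}$ at which all $\lambda_i$ are differentiable relative to $\mathfrak{m}$ (i.e. $\lambda_i(\mathbf{y})=\lambda_i(\mathbf{x})+\nabla\lambda_i(\mathbf{x})\cdot(\mathbf{y}-\mathbf{x})+o(|\mathbf{y}-\mathbf{x}|)$ for $\mathbf{y}\in\mathfrak{m}$). $\mathcal{P}_1\Lambda^2(\mathfrak{m})$ is the space of differential 2-forms on $\mathfrak{m}$ with polynomial coefficients of degree at most 1, identified via vector proxies $w_1dx_2dx_3+w_2dx_3dx_1+w_3dx_1dx_2\leftrightarrow(w_1,w_2,w_3)^T$ with the vector fields all of whose components are polynomials of degree at most 1. Span means finite real linear combinations. *)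

theory Defs
  imports "HOL-Analysis.Analysis"
begin

definition linear_poly :: "(real^3 \<Rightarrow> real) \<Rightarrow> bool" where
  "linear_poly p \<longleftrightarrow> (\<exists>a b. \<forall>x. p x = a + b \<bullet> x)"

(* Only the values of the coordinate functions on M are constrained. *)
definition gen_barycentric_coords ::
    "(real^3) set \<Rightarrow> 'i set \<Rightarrow> ('i \<Rightarrow> real^3) \<Rightarrow> ('i \<Rightarrow> real^3 \<Rightarrow> real) \<Rightarrow> bool" where
  "gen_barycentric_coords M I v lam \<longleftrightarrow>
     (\<forall>i\<in>I. \<forall>x\<in>M. 0 \<le> lam i x) \<and>
     (\<forall>L. linear_poly L \<longrightarrow> (\<forall>x\<in>M. L x = (\<Sum>i\<in>I. L (v i) * lam i x)))"

(* The derivative is taken relative to M, so boundary points of M are included.  It is unique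
   at every point of M when M is convex with nonempty interior. *)
definition grad_within :: "(real^3) set \<Rightarrow> (real^3 \<Rightarrow> real) \<Rightarrow> real^3 \<Rightarrow> real^3" where
  "grad_within M f x = (THE g. (f has_derivative (\<lambda>h. g \<bullet> h)) (at x within M))"

definition diff_points :: "(real^3) set \<Rightarrow> 'i set \<Rightarrow> ('i \<Rightarrow> real^3 \<Rightarrow> real) \<Rightarrow> (real^3) set" where
  "diff_points M I lam = {x\<in>M. \<forall>i\<in>I. lam i differentiable (at x within M)}"

(* The matrix a b^T for column vectors a and b. *)
definition outer_product :: "real^3 \<Rightarrow> real^3 \<Rightarrow> real^3^3" where
  "outer_product a b = (\<chi> r s. a $ r * b $ s)"

(* Vector proxies (w1, w2, w3) of the 2-forms w1 dx2 dx3 + w2 dx3 dx1 + w3 dx1 dx2 on M.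
   A field on M is represented by any total function with the right values on M. *)
definition P1_Lambda2 :: "(real^3) set \<Rightarrow> (real^3 \<Rightarrow> real^3) set" where
  "P1_Lambda2 M = {w. \<forall>s. \<exists>p. linear_poly p \<and> (\<forall>x\<in>M. w x $ s = p x)}"

(* Finite real linear combinations of members of S, compared as functions on D only. *)
definition span_on :: "(real^3) set \<Rightarrow> (real^3 \<Rightarrow> real^3) set \<Rightarrow> (real^3 \<Rightarrow> real^3) set" where
  "span_on D S =
     {w. \<exists>T c. finite T \<and> T \<subseteq> S \<and> (\<forall>x\<in>D. w x = (\<Sum>f\<in>T. c f *\<^sub>R f x))}"

end

theory Submission
  imports Defs
begin

text \<open>Differentiating \<open>L = (\<Sum>i\<in>I. L (v i) * lam i)\<close> gives \<open>(\<Sum>j\<in>I. (a \<bullet> v j) *\<^sub>R G j) = a\<close> and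
  \<open>(\<Sum>j\<in>I. G j) = 0\<close> for the gradients \<open>G\<close> at a fixed point, so \<open>(\<Sum>j\<in>I. (a \<bullet> (v j - p)) *\<^sub>R G j) = a\<close>
  for every \<open>p\<close>. This resolution of the identity induces one on bivectors,
  \<open>(\<Sum>j\<in>I. \<Sum>k\<in>I. (c \<bullet> cross3 (v j - p) (v k - p)) *\<^sub>R cross3 (G j) (G k)) = 2 *\<^sub>R c\<close>.
  The first identity takes \<open>p = v i\<close>, the second \<open>p = 0\<close> and \<open>c = A *v v i\<close>; both are then averaged
  over \<open>i\<close> with the weights \<open>lam i x\<close>.\<close>

section \<open>Derivatives and gradients relative to a convex set\<close>

text \<open>Along the segment from \<open>x\<close> to a point \<open>y\<close> of \<open>S\<close>,
  one-variable uniqueness makes both derivatives agree on \<open>y - x\<close>. An interior point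
  \<open>z\<close> then suffices: every \<open>h\<close> is a multiple of a difference of two such
  directions.\<close>

lemma has_derivative_within_convex_unique:
  fixes f :: "'a::real_normed_vector \<Rightarrow> 'b::real_normed_vector"
  assumes "convex S" "interior S \<noteq> {}" "x \<in> S"
    and f': "(f has_derivative f') (at x within S)"
    and f'': "(f has_derivative f'') (at x within S)"
  shows "f' = f''"
proof
  fix h :: 'a
  interpret f': bounded_linear f' using f' by (rule has_derivative_bounded_linear)
  interpret f'': bounded_linear f'' using f'' by (rule has_derivative_bounded_linear)
  have along: "(f o (\<lambda>t::real. x + t *\<^sub>R (y - x)) has_vector_derivative F (y - x)) (at 0 within {0..1})"
    if y: "y \<in> S" and F: "(f has_derivative F) (at x within S)" for y F
  proof -
    interpret F: bounded_linear F using F by (rule has_derivative_bounded_linear)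
    have sub: "(\<lambda>t::real. x + t *\<^sub>R (y - x)) ` {0..1} \<subseteq> S"
    proof clarify
      fix t :: real
      assume "t \<in> {0..1}"
      then have "(1 - t) *\<^sub>R x + t *\<^sub>R y \<in> S"
        using convexD_alt[OF \<open>convex S\<close> \<open>x \<in> S\<close> y] by simp
      then show "x + t *\<^sub>R (y - x) \<in> S"
        by (simp add: algebra_simps)
    qed
    have "((\<lambda>t::real. x + t *\<^sub>R (y - x)) has_derivative (\<lambda>t. t *\<^sub>R (y - x))) (at 0 within {0..1})"
      by (auto intro!: derivative_eq_intros)
    moreover have "(f has_derivative F)
        (at (x + (0::real) *\<^sub>R (y - x)) within (\<lambda>t::real. x + t *\<^sub>R (y - x)) ` {0..1})"
      using has_derivative_subset[OF F sub] by simp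
    ultimately have "(f o (\<lambda>t::real. x + t *\<^sub>R (y - x)) has_derivative F o (\<lambda>t. t *\<^sub>R (y - x)))
        (at 0 within {0..1})"
      by (rule diff_chain_within)
    then show ?thesis
      by (simp add: has_vector_derivative_def o_def F.scaleR)
  qed
  have eq: "f' (y - x) = f'' (y - x)" if "y \<in> S" for y
    \<comment> \<open>Uniqueness is used at the endpoint 0 of the parameter interval, so
      \<open>x\<close> may lie on the boundary of \<open>S\<close>.\<close>
    by (rule vector_derivative_unique_within_closed_interval[where a = 0 and b = "1::real" and x = 0])
      (use along[OF that f'] along[OF that f''] in \<open>simp_all add: cbox_interval\<close>)
  obtain z e where e: "e > 0" and ball: "ball z e \<subseteq> S"
    using \<open>interior S \<noteq> {}\<close> by (auto simp: mem_interior)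
  \<comment> \<open>Small enough that \<open>z + s *\<^sub>R h\<close> stays in the ball around
    \<open>z\<close>; adding 1 keeps the denominator positive when \<open>h = 0\<close>.\<close>
  define s where "s = e / (2 * (norm h + 1))"
  have pos: "norm h + 1 > 0"
    using norm_ge_zero[of h] by linarith
  then have s: "s > 0"
    using e by (simp add: s_def)
  have "norm h < 2 * (norm h + 1)"
    using norm_ge_zero[of h] by argo
  then have "s * norm h < s * (2 * (norm h + 1))"
    using s by (rule mult_strict_left_mono)
  also have "\<dots> = e"
    using pos by (simp add: s_def)
  finally have "s * norm h < e" .
  then have "z + s *\<^sub>R h \<in> S"
    using ball s by (auto simp: dist_norm)
  moreover have "z \<in> S"
    using ball e by auto
  ultimately have "f' ((z + s *\<^sub>R h - x) - (z - x)) = f'' ((z + s *\<^sub>R h - x) - (z - x))"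
    by (simp only: eq f'.diff[of "z + s *\<^sub>R h - x"] f''.diff[of "z + s *\<^sub>R h - x"])
  then show "f' h = f'' h"
    using s by (simp add: f'.scaleR f''.scaleR)
qed

text \<open>Justifies the definite description in \<open>grad_within\<close>:
  \<open>adjoint F 1\<close> is the Riesz vector of the derivative \<open>F\<close>, and uniqueness
  is the preceding lemma.\<close>

lemma grad_within_has_derivative:
  assumes "convex S" "interior S \<noteq> {}" "x \<in> S" "f differentiable (at x within S)"
  shows "(f has_derivative (\<lambda>h. grad_within S f x \<bullet> h)) (at x within S)"
proof -
  obtain F where F: "(f has_derivative F) (at x within S)"
    using assms(4) by (auto simp: differentiable_def)
  then have "linear F"
    by (rule has_derivative_linear)
  then have "F = (\<lambda>h. adjoint F 1 \<bullet> h)"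
    by (simp add: fun_eq_iff adjoint_clauses(2))
  with F have g: "(f has_derivative (\<lambda>h. adjoint F 1 \<bullet> h)) (at x within S)"
    by simp
  show ?thesis
    unfolding grad_within_def
  proof (rule theI[of "\<lambda>g. (f has_derivative (\<lambda>h. g \<bullet> h)) (at x within S)", OF g])
    fix g
    assume "(f has_derivative (\<lambda>h. g \<bullet> h)) (at x within S)"
    from has_derivative_within_convex_unique[OF assms(1-3) this g]
    show "g = adjoint F 1"
      using vector_eq_rdot by metis
  qed
qed

lemma sum_scaled_gradients:
  fixes lam :: "'i \<Rightarrow> 'a::real_inner \<Rightarrow> real"
  assumes S: "convex S" "interior S \<noteq> {}" "x \<in> S"
    and G: "\<And>i. i \<in> I \<Longrightarrow> (lam i has_derivative (\<lambda>h. G i \<bullet> h)) (at x within S)"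
    and L: "\<And>y. y \<in> S \<Longrightarrow> a + b \<bullet> y = (\<Sum>i\<in>I. c i * lam i y)"
  shows "(\<Sum>i\<in>I. c i *\<^sub>R G i) = b"
proof -
  have "((\<lambda>y. \<Sum>i\<in>I. c i * lam i y) has_derivative (\<lambda>h. \<Sum>i\<in>I. c i * (G i \<bullet> h))) (at x within S)"
    by (intro has_derivative_sum has_derivative_mult_right G)
  \<comment> \<open>A derivative relative to \<open>S\<close> sees only values on \<open>S\<close>,
    which is where the two functions agree.\<close>
  then have "((\<lambda>y. a + b \<bullet> y) has_derivative (\<lambda>h. \<Sum>i\<in>I. c i * (G i \<bullet> h))) (at x within S)"
    by (rule has_derivative_transform[rotated 2]) (use S L in auto)
  moreover have "((\<lambda>y. a + b \<bullet> y) has_derivative (\<lambda>h. b \<bullet> h)) (at x within S)"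
    by (auto intro!: derivative_eq_intros)
  ultimately have "(\<lambda>h. \<Sum>i\<in>I. c i * (G i \<bullet> h)) = (\<lambda>h. b \<bullet> h)"
    by (rule has_derivative_within_convex_unique[OF S])
  then have "\<forall>h. (\<Sum>i\<in>I. c i *\<^sub>R G i) \<bullet> h = b \<bullet> h"
    by (simp add: fun_eq_iff inner_sum_left)
  then show ?thesis
    by (simp only: vector_eq_rdot)
qed

text \<open>The hypothesis says that the matrices \<open>G j\<close> times \<open>u j\<close>
  transposed sum to the identity. Rotating the triple product lets it collapse the sum over
  \<open>k\<close> to \<open>cross3 (G j) (cross3 c (u j))\<close>. After Lagrange's expansion, the
  sum over \<open>j\<close> is the trace 3 times \<open>c\<close>, minus \<open>c\<close>.\<close>

lemma sum_cross3_resolution: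
  fixes u G :: "'i \<Rightarrow> real^3"
  assumes R: "\<And>a. (\<Sum>j\<in>I. (a \<bullet> u j) *\<^sub>R G j) = a"
  shows "(\<Sum>j\<in>I. \<Sum>k\<in>I. (c \<bullet> cross3 (u j) (u k)) *\<^sub>R cross3 (G j) (G k)) = 2 *\<^sub>R c"
proof -
  have inner: "(\<Sum>k\<in>I. (c \<bullet> cross3 (u j) (u k)) *\<^sub>R cross3 (G j) (G k))
      = (G j \<bullet> u j) *\<^sub>R c - (G j \<bullet> c) *\<^sub>R u j" for j
  proof -
    have lin: "linear (cross3 (G j))"
      using bilinear_cross by (simp add: bilinear_def)
    have "(\<Sum>k\<in>I. (c \<bullet> cross3 (u j) (u k)) *\<^sub>R cross3 (G j) (G k))
        = (\<Sum>k\<in>I. (cross3 c (u j) \<bullet> u k) *\<^sub>R cross3 (G j) (G k))"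
      by (metis cross_triple inner_commute)
    also have "\<dots> = cross3 (G j) (\<Sum>k\<in>I. (cross3 c (u j) \<bullet> u k) *\<^sub>R G k)"
      by (simp add: linear_sum[OF lin] cross_mult_right)
    also have "\<dots> = cross3 (G j) (cross3 c (u j))"
      by (simp only: R)
    finally show ?thesis
      by (simp add: Lagrange)
  qed
  \<comment> \<open>The transpose of the identity matrix is again the identity.\<close>
  have transposed: "(\<Sum>j\<in>I. (G j \<bullet> c) *\<^sub>R u j) = c"
  proof -
    have "(\<Sum>j\<in>I. (G j \<bullet> c) *\<^sub>R u j) \<bullet> a = c \<bullet> a" for a
    proof -
      have "(\<Sum>j\<in>I. (G j \<bullet> c) *\<^sub>R u j) \<bullet> a = (\<Sum>j\<in>I. (a \<bullet> u j) *\<^sub>R G j) \<bullet> c"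
        by (simp add: inner_sum_left inner_sum_right inner_commute mult.commute)
      then show ?thesis
        by (simp add: R inner_commute)
    qed
    then show ?thesis
      using vector_eq_rdot by blast
  qed
  \<comment> \<open>The diagonal entries of the resolution, whose sum is the trace.\<close>
  have "(\<Sum>j\<in>I. u j $ b * G j $ b) = 1" for b
    using arg_cong[OF R[of "axis b 1"], of "\<lambda>w. w $ b"] by (simp add: inner_axis')
  then have "(\<Sum>j\<in>I. G j \<bullet> u j) = 3"
    by (simp add: inner_vec_def sum_3 sum.distrib mult.commute)
  then show ?thesis
    by (simp add: inner sum_subtractf transposed flip: scaleR_sum_left)
      (simp add: vec_eq_iff)
qed

section \<open>Consequences of linear precision\<close>

lemma gen_barycentric_coords_affine:
  assumes "gen_barycentric_coords M I v lam" "x \<in> M"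
  shows "a + b \<bullet> x = (\<Sum>i\<in>I. (a + b \<bullet> v i) * lam i x)"
proof -
  have lin: "linear_poly (\<lambda>x. a + b \<bullet> x)"
    by (auto simp: linear_poly_def)
  have "\<And>L. linear_poly L \<Longrightarrow> L x = (\<Sum>i\<in>I. L (v i) * lam i x)"
    using assms by (simp add: gen_barycentric_coords_def)
  from this[OF lin] show ?thesis .
qed

lemma gen_barycentric_coords_position:
  assumes "gen_barycentric_coords M I v lam" "x \<in> M"
  shows "(\<Sum>i\<in>I. lam i x *\<^sub>R v i) = x"
proof -
  have "(\<Sum>i\<in>I. lam i x *\<^sub>R v i) \<bullet> b = x \<bullet> b" for b
    using gen_barycentric_coords_affine[OF assms, of 0 b]
    by (simp add: inner_sum_left inner_sum_right inner_commute mult.commute)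
  then show ?thesis
    using vector_eq_rdot by blast
qed

text \<open>The function \<open>a \<bullet> (y - p)\<close> has gradient \<open>a\<close> whatever
  \<open>p\<close> is, so the base point can be chosen freely later.\<close>

lemma gen_barycentric_coords_grad_resolution:
  assumes M: "convex M" "interior M \<noteq> {}" "gen_barycentric_coords M I v lam"
    and x: "x \<in> diff_points M I lam"
  shows "(\<Sum>j\<in>I. (a \<bullet> (v j - p)) *\<^sub>R grad_within M (lam j) x) = a"
proof (rule sum_scaled_gradients)
  show "(lam i has_derivative (\<lambda>h. grad_within M (lam i) x \<bullet> h)) (at x within M)" if "i \<in> I" for i
    using that x M by (intro grad_within_has_derivative) (auto simp: diff_points_def)
  show "- (a \<bullet> p) + a \<bullet> y = (\<Sum>i\<in>I. a \<bullet> (v i - p) * lam i y)" if "y \<in> M" for y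
    using gen_barycentric_coords_affine[OF M(3) that, of "- (a \<bullet> p)" a]
    by (simp add: inner_diff_right)
qed (use x M in \<open>auto simp: diff_points_def\<close>)

text \<open>Serves twice: as the first identity applied to a vector \<open>c\<close>, and as the
  expansion of the constant field \<open>c\<close> in the span.\<close>

lemma sum_difference_cross_eq:
  assumes M: "convex M" "interior M \<noteq> {}" "gen_barycentric_coords M I v lam"
    and x: "x \<in> diff_points M I lam"
  shows "(\<Sum>i\<in>I. \<Sum>j\<in>I. \<Sum>k\<in>I. (c \<bullet> cross3 (v j - v i) (v k - v i)) *\<^sub>R
      (lam i x *\<^sub>R cross3 (grad_within M (lam j) x) (grad_within M (lam k) x))) = 2 *\<^sub>R c"
proof -
  have "x \<in> M"
    using x by (simp add: diff_points_def)
  have "(\<Sum>j\<in>I. \<Sum>k\<in>I. (c \<bullet> cross3 (v j - v i) (v k - v i)) *\<^sub>R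
      (lam i x *\<^sub>R cross3 (grad_within M (lam j) x) (grad_within M (lam k) x)))
      = lam i x *\<^sub>R (2 *\<^sub>R c)" for i
    using arg_cong[OF sum_cross3_resolution
        [OF gen_barycentric_coords_grad_resolution[OF M x, of _ "v i"], of c], of "\<lambda>w. lam i x *\<^sub>R w"]
    by (simp add: scaleR_sum_right mult.commute)
  \<comment> \<open>Linear precision for the constant function 1.\<close>
  moreover have "(\<Sum>i\<in>I. lam i x) = 1"
    using gen_barycentric_coords_affine[OF M(3) \<open>x \<in> M\<close>, of 1 0] by simp
  ultimately show ?thesis
    by (simp flip: scaleR_sum_left sum_distrib_right)
qed

text \<open>For fixed \<open>i\<close> the double sum gives \<open>A *v v i\<close> with weight
  \<open>2 * lam i x\<close>; linearity of \<open>A\<close> and linear precision for the position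
  then produce \<open>A *v x\<close>.\<close>

lemma sum_matrix_cross_eq:
  assumes M: "convex M" "interior M \<noteq> {}" "gen_barycentric_coords M I v lam"
    and x: "x \<in> diff_points M I lam"
  shows "(\<Sum>i\<in>I. \<Sum>j\<in>I. \<Sum>k\<in>I. ((A *v v i) \<bullet> cross3 (v j) (v k)) *\<^sub>R
      (lam i x *\<^sub>R cross3 (grad_within M (lam j) x) (grad_within M (lam k) x))) = 2 *\<^sub>R (A *v x)"
proof -
  have "x \<in> M"
    using x by (simp add: diff_points_def)
  have "(\<Sum>j\<in>I. \<Sum>k\<in>I. ((A *v v i) \<bullet> cross3 (v j) (v k)) *\<^sub>R
      (lam i x *\<^sub>R cross3 (grad_within M (lam j) x) (grad_within M (lam k) x)))
      = 2 *\<^sub>R (A *v (lam i x *\<^sub>R v i))" for i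
    using arg_cong[OF sum_cross3_resolution
        [OF gen_barycentric_coords_grad_resolution[OF M x, of _ 0], of "A *v v i"],
        of "\<lambda>w. lam i x *\<^sub>R w"]
    by (simp add: scaleR_sum_right mult.commute matrix_vector_mult_scaleR)
  then have "(\<Sum>i\<in>I. \<Sum>j\<in>I. \<Sum>k\<in>I. ((A *v v i) \<bullet> cross3 (v j) (v k)) *\<^sub>R
      (lam i x *\<^sub>R cross3 (grad_within M (lam j) x) (grad_within M (lam k) x)))
      = 2 *\<^sub>R (A *v (\<Sum>i\<in>I. lam i x *\<^sub>R v i))"
    by (simp add: linear_sum[OF matrix_vector_mul_linear] flip: scaleR_sum_right)
  then show ?thesis
    by (simp only: gen_barycentric_coords_position[OF M(3) \<open>x \<in> M\<close>])
qed

section \<open>Matrix form, spans and affine fields\<close>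

lemma sum_matrix_vector_mult: "(\<Sum>i\<in>I. B i) *v c = (\<Sum>i\<in>I. B i *v c)"
  for B :: "'i \<Rightarrow> real^'n^'m"
  by (induction I rule: infinite_finite_induct) (simp_all add: matrix_vector_mult_add_rdistrib)

lemma outer_product_mult_vec: "outer_product a b *v c = (c \<bullet> b) *\<^sub>R a"
  by (simp add: outer_product_def matrix_vector_mult_def vec_eq_iff inner_vec_def sum_3 algebra_simps)

text \<open>Distinct indices may yield the same function, so coefficients are summed over the fibres of \<open>F\<close>.\<close>

lemma span_onI:
  assumes "finite J" "F ` J \<subseteq> S"
    and w: "\<And>x. x \<in> D \<Longrightarrow> w x = (\<Sum>j\<in>J. c j *\<^sub>R F j x)"
  shows "w \<in> span_on D S"
proof -
  have "w x = (\<Sum>f\<in>F ` J. (\<Sum>j | j \<in> J \<and> F j = f. c j) *\<^sub>R f x)" if "x \<in> D" for x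
  proof -
    have "w x = (\<Sum>f\<in>F ` J. \<Sum>j | j \<in> J \<and> F j = f. c j *\<^sub>R F j x)"
      unfolding w[OF that] by (rule sum.image_gen[OF \<open>finite J\<close>])
    then show ?thesis
      by (simp add: scaleR_sum_left)
  qed
  then show ?thesis
    using assms(1,2) unfolding span_on_def mem_Collect_eq
    by (intro exI[of _ "F ` J"] exI[of _ "\<lambda>f. \<Sum>j | j \<in> J \<and> F j = f. c j"]) simp
qed

lemma P1_Lambda2_affine:
  assumes "w \<in> P1_Lambda2 M"
  obtains a :: "real^3" and A :: "real^3^3" where "\<And>x. x \<in> M \<Longrightarrow> w x = a + A *v x"
proof -
  from assms have "\<forall>s. \<exists>a b. \<forall>x\<in>M. w x $ s = a + b \<bullet> x"
    unfolding P1_Lambda2_def linear_poly_def by fastforce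
  then obtain a b where "\<And>s x. x \<in> M \<Longrightarrow> w x $ s = a s + b s \<bullet> x"
    by metis
  \<comment> \<open>The component gradients \<open>b s\<close> become the rows of the
    matrix.\<close>
  then have "w x = (\<chi> s. a s) + (\<chi> s. b s) *v x" if "x \<in> M" for x
    using that by (simp add: vec_eq_iff matrix_vector_mul_component)
  then show thesis
    by (rule that)
qed

theorem theorem4p3:
  fixes M :: "(real^3) set"
    and I :: "'i set"
    and v :: "'i \<Rightarrow> real^3"
    and lam :: "'i \<Rightarrow> real^3 \<Rightarrow> real"
  assumes "polyhedron M"
    and "interior M \<noteq> {}"
    and "bij_betw v I {p. p extreme_point_of M}"
    and "gen_barycentric_coords M I v lam"
  shows "(\<forall>x\<in>diff_points M I lam.
            (1/2) *\<^sub>R (\<Sum>i\<in>I. \<Sum>j\<in>I. \<Sum>k\<in>I.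
              lam i x *\<^sub>R outer_product
                (cross3 (grad_within M (lam j) x) (grad_within M (lam k) x))
                (cross3 (v j - v i) (v k - v i)))
            = (mat 1 :: real^3^3))
       \<and> (\<forall>A :: real^3^3. \<forall>x\<in>diff_points M I lam.
            (1/2) *\<^sub>R (\<Sum>i\<in>I. \<Sum>j\<in>I. \<Sum>k\<in>I.
              ((A *v v i) \<bullet> cross3 (v j) (v k)) *\<^sub>R
                (lam i x *\<^sub>R cross3 (grad_within M (lam j) x) (grad_within M (lam k) x)))
            = A *v x)
       \<and> P1_Lambda2 M \<subseteq> span_on (diff_points M I lam)
            {\<lambda>x. lam i x *\<^sub>R cross3 (grad_within M (lam j) x) (grad_within M (lam k) x)
              | i j k. i \<in> I \<and> j \<in> I \<and> k \<in> I}"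
proof (intro conjI ballI allI subsetI)
  have conv: "convex M"
    using assms(1) by (rule polyhedron_imp_convex)
  note diff = sum_difference_cross_eq[OF conv assms(2,4)]
    and mat = sum_matrix_cross_eq[OF conv assms(2,4)]
  let ?N = "\<lambda>x i j k. lam i x *\<^sub>R cross3 (grad_within M (lam j) x) (grad_within M (lam k) x)"
  show "(1/2) *\<^sub>R (\<Sum>i\<in>I. \<Sum>j\<in>I. \<Sum>k\<in>I. lam i x *\<^sub>R outer_product
          (cross3 (grad_within M (lam j) x) (grad_within M (lam k) x))
          (cross3 (v j - v i) (v k - v i))) = (mat 1 :: real^3^3)"
    if x: "x \<in> diff_points M I lam" for x
  \<comment> \<open>Testing on vectors \<open>c\<close> turns each outer product into a scalar
    coefficient times a cross product of gradients.\<close>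
  proof (rule matrix_eq[THEN iffD2], rule allI)
    fix c :: "real^3"
    have "((1/2) *\<^sub>R (\<Sum>i\<in>I. \<Sum>j\<in>I. \<Sum>k\<in>I. lam i x *\<^sub>R outer_product
          (cross3 (grad_within M (lam j) x) (grad_within M (lam k) x))
          (cross3 (v j - v i) (v k - v i)))) *v c
        = (1/2) *\<^sub>R (\<Sum>i\<in>I. \<Sum>j\<in>I. \<Sum>k\<in>I.
            (c \<bullet> cross3 (v j - v i) (v k - v i)) *\<^sub>R ?N x i j k)"
      by (simp add: sum_matrix_vector_mult outer_product_mult_vec mult.commute
          flip: scaleR_matrix_vector_assoc)
    also have "\<dots> = mat 1 *v c"
      using diff[OF x, of c] by simp
    finally show "((1/2) *\<^sub>R (\<Sum>i\<in>I. \<Sum>j\<in>I. \<Sum>k\<in>I. lam i x *\<^sub>R outer_product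
          (cross3 (grad_within M (lam j) x) (grad_within M (lam k) x))
          (cross3 (v j - v i) (v k - v i)))) *v c = mat 1 *v c" .
  qed
  show "(1/2) *\<^sub>R (\<Sum>i\<in>I. \<Sum>j\<in>I. \<Sum>k\<in>I. ((A *v v i) \<bullet> cross3 (v j) (v k)) *\<^sub>R ?N x i j k) = A *v x"
    if "x \<in> diff_points M I lam" for A :: "real^3^3" and x
    using mat[OF that, of A] by simp
  show "w \<in> span_on (diff_points M I lam) {\<lambda>x. ?N x i j k | i j k. i \<in> I \<and> j \<in> I \<and> k \<in> I}"
    if "w \<in> P1_Lambda2 M" for w
  proof -
    have "finite I"
      using bij_betw_finite[OF assms(3)] finite_polyhedron_extreme_points[OF assms(1)] by simp
    obtain a and A :: "real^3^3" where w: "\<And>x. x \<in> M \<Longrightarrow> w x = a + A *v x"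
      using P1_Lambda2_affine[OF \<open>w \<in> P1_Lambda2 M\<close>] by blast
    \<comment> \<open>The first summand reproduces the constant part \<open>a\<close>, the second
      the linear part \<open>A *v x\<close>; neither depends on \<open>x\<close>, and 1/2 cancels
      the factor 2 in both expansions.\<close>
    define c where "c = (\<lambda>i j k. (1/2) *
      (a \<bullet> cross3 (v j - v i) (v k - v i) + (A *v v i) \<bullet> cross3 (v j) (v k)))"
    have "w x = (\<Sum>(i, j, k)\<in>I \<times> I \<times> I. c i j k *\<^sub>R ?N x i j k)" if x: "x \<in> diff_points M I lam" for x
    proof -
      have "(\<Sum>i\<in>I. \<Sum>j\<in>I. \<Sum>k\<in>I. c i j k *\<^sub>R ?N x i j k)
          = (1/2) *\<^sub>R (\<Sum>i\<in>I. \<Sum>j\<in>I. \<Sum>k\<in>I.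
              (a \<bullet> cross3 (v j - v i) (v k - v i)) *\<^sub>R ?N x i j k)
          + (1/2) *\<^sub>R (\<Sum>i\<in>I. \<Sum>j\<in>I. \<Sum>k\<in>I.
              ((A *v v i) \<bullet> cross3 (v j) (v k)) *\<^sub>R ?N x i j k)"
        unfolding c_def scaleR_sum_right sum.distrib[symmetric]
        by (intro sum.cong refl) (simp add: algebra_simps add_divide_distrib)
      also have "\<dots> = a + A *v x"
        using diff[OF x, of a] mat[OF x, of A] by simp
      also have "\<dots> = w x"
        using w x by (simp add: diff_points_def)
      finally show ?thesis
        by (simp add: sum.cartesian_product)
    qed
    moreover have "(\<lambda>(i, j, k) x. ?N x i j k) ` (I \<times> I \<times> I)
        \<subseteq> {\<lambda>x. ?N x i j k | i j k. i \<in> I \<and> j \<in> I \<and> k \<in> I}"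
      by clarsimp (intro exI conjI, rule refl, assumption+)
    ultimately show ?thesis
      using \<open>finite I\<close>
      by (intro span_onI[of "I \<times> I \<times> I" "\<lambda>(i, j, k) x. ?N x i j k" _ _ _ "\<lambda>(i, j, k). c i j k"])
        (auto simp: case_prod_unfold)
  qed
qed

end
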